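(* Let $G$ be a graph with ${\rm diam}(G)=3$ and let $\mathcal{I}$ be the set of all maximal independent sets of $G$. Then $\Gamma_{\rho}(G)=|V(G)|-m(G)+2$, where $$m(G)=\min_{A\in\mathcal{I}}\{|A|+|Q| : Q\text{ is a maximal clique of minimum cardinality of } D(G)-A\}.$$
   Context: Graphs are finite and simple; $d(u,v)$ is the distance in $G$. Two vertices $x,y$ form a diametrical pair if $d(x,y)={\rm diam}(G)$. The diametrical graph $D(G)$ has vertex set $V(G)$, with $x,y$ adjacent iff they form a diametrical pair of $G$; $D(G)-A$ is obtained by deleting the vertices of $A$. A maximal clique is a clique not contained in a larger clique. A packing coloring $c:V(G)\to\{1,\dots,k\}$ satisfies: $c(u)=c(v)=i$, $u\ne v$, implies $d(u,v)>i$. The Grundy packing chromatic number $\Gamma_{\rho}(G)$ is the maximum number of colors $k$ in a packing coloring $c:V(G)\to\{1,\dots,k\}$ using all $k$ colors in which every vertex $v$ with $c(v)=i$ has, for every $j\in\{1,\dots,i-1\}$, a vertex $u$ with $c(u)=j$ and $d(u,v)\le j$ (equivalently, the maximum number of colors produced by the greedy procedure that processes vertices in some order and assigns each vertex the smallest color $i$ with no already-colored vertex of color $i$ at distance at most $i$). *)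

theory Defs
  imports "Graph_Theory.Graph_Theory"
begin

(* Graphs are symmetric digraphs in Graph_Theory; its locale "graph" is that of finite simple
   graphs. Distances live in ereal, with value \<infinity> for vertices in different components, so
   a graph of finite diameter is connected. *)

definition gdist :: "('a, 'b) pre_digraph \<Rightarrow> 'a \<Rightarrow> 'a \<Rightarrow> ereal" where
  "gdist G u v = wf_digraph.\<mu> G (\<lambda>_. 1) u v"

definition gdiam :: "('a, 'b) pre_digraph \<Rightarrow> ereal" where
  "gdiam G = (SUP u\<in>verts G. SUP v\<in>verts G. gdist G u v)"

definition diametrical_pair :: "('a, 'b) pre_digraph \<Rightarrow> 'a \<Rightarrow> 'a \<Rightarrow> bool" where
  "diametrical_pair G x y \<longleftrightarrow>
     x \<in> verts G \<and> y \<in> verts G \<and> x \<noteq> y \<and> gdist G x y = gdiam G"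

definition diametrical_graph :: "('a, 'b) pre_digraph \<Rightarrow> ('a, 'a \<times> 'a) pre_digraph" where
  "diametrical_graph G =
     with_proj \<lparr>pverts = verts G, parcs = {(x, y). diametrical_pair G x y}\<rparr>"

definition delete_verts :: "('a, 'b) pre_digraph \<Rightarrow> 'a set \<Rightarrow> ('a, 'b) pre_digraph" where
  "delete_verts G A = G \<restriction> (verts G - A)"

definition independent_set :: "('a, 'b) pre_digraph \<Rightarrow> 'a set \<Rightarrow> bool" where
  "independent_set G A \<longleftrightarrow> A \<subseteq> verts G \<and> (\<forall>u\<in>A. \<forall>v\<in>A. \<not> u \<rightarrow>\<^bsub>G\<^esub> v)"

definition maximal_independent_set :: "('a, 'b) pre_digraph \<Rightarrow> 'a set \<Rightarrow> bool" where
  "maximal_independent_set G A \<longleftrightarrow>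
     independent_set G A \<and> (\<nexists>B. independent_set G B \<and> A \<subset> B)"

definition clique :: "('a, 'b) pre_digraph \<Rightarrow> 'a set \<Rightarrow> bool" where
  "clique G Q \<longleftrightarrow> Q \<subseteq> verts G \<and> (\<forall>u\<in>Q. \<forall>v\<in>Q. u \<noteq> v \<longrightarrow> u \<rightarrow>\<^bsub>G\<^esub> v)"

definition maximal_clique :: "('a, 'b) pre_digraph \<Rightarrow> 'a set \<Rightarrow> bool" where
  "maximal_clique G Q \<longleftrightarrow> clique G Q \<and> (\<nexists>R. clique G R \<and> Q \<subset> R)"

definition minimum_maximal_clique :: "('a, 'b) pre_digraph \<Rightarrow> 'a set \<Rightarrow> bool" where
  "minimum_maximal_clique G Q \<longleftrightarrow>
     maximal_clique G Q \<and> (\<forall>R. maximal_clique G R \<longrightarrow> card Q \<le> card R)"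

definition m_number :: "('a, 'b) pre_digraph \<Rightarrow> nat" where
  "m_number G = Min {card A + card Q | A Q.
     maximal_independent_set G A \<and>
     minimum_maximal_clique (delete_verts (diametrical_graph G) A) Q}"

definition packing_coloring :: "('a, 'b) pre_digraph \<Rightarrow> nat \<Rightarrow> ('a \<Rightarrow> nat) \<Rightarrow> bool" where
  "packing_coloring G k c \<longleftrightarrow>
     c ` verts G \<subseteq> {1..k} \<and>
     (\<forall>u\<in>verts G. \<forall>v\<in>verts G. u \<noteq> v \<and> c u = c v \<longrightarrow> gdist G u v > ereal (real (c u)))"

definition grundy_packing_coloring ::
  "('a, 'b) pre_digraph \<Rightarrow> nat \<Rightarrow> ('a \<Rightarrow> nat) \<Rightarrow> bool" where
  "grundy_packing_coloring G k c \<longleftrightarrow>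
     packing_coloring G k c \<and> c ` verts G = {1..k} \<and>
     (\<forall>v\<in>verts G. \<forall>j\<in>{1..<c v}.
        \<exists>u\<in>verts G. c u = j \<and> gdist G u v \<le> ereal (real j))"

definition grundy_packing_number :: "('a, 'b) pre_digraph \<Rightarrow> nat" where
  "grundy_packing_number G = Max {k. \<exists>c. grundy_packing_coloring G k c}"

end

theory Submission
  imports Defs
begin

text \<open>
  In a graph of diameter 3 any two distinct vertices at distance greater than 2 form a diametrical
  pair, and no two distinct vertices are at distance greater than 3. Hence in a Grundy packing
  coloring color 1 is a maximal independent set \<open>A\<close>, color 2 is a maximal clique \<open>Q\<close> of
  \<open>D(G) - A\<close>, and each further color is used exactly once. Conversely, every such pair
  \<open>(A, Q)\<close> arises in this way, because the Grundy condition for a color \<open>j \<ge> 3\<close> holds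
  automatically. So the numbers of colors that occur are exactly the values
  \<open>|V(G)| - |A| - |Q| + 2\<close>.
\<close>

section \<open>Distances as lengths of shortest walks\<close>

context graph
begin

lemma awalk_cost_1: "awalk_cost (\<lambda>_. 1) p = real (length p)"
  by (induction p) auto

lemma gdist_le_length: "awalk u p v \<Longrightarrow> gdist G u v \<le> ereal (real (length p))"
  unfolding gdist_def using min_cost_le_walk_cost[of u p v "\<lambda>_. 1"] by (simp add: awalk_cost_1)

text \<open>With unit weights a finite distance is the length of some walk, hence a natural number
  inside \<open>ereal\<close>. Every integrality argument below rests on this.\<close>

lemma gdist_attained:
  assumes "gdist G u v < \<infinity>"
  obtains p where "awalk u p v" and "gdist G u v = ereal (real (length p))"
proof -
  have "u \<rightarrow>\<^sup>* v"
    using assms unfolding gdist_def by (simp only: \<mu>_reach_conv)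
  then obtain p where "apath u p v" "gdist G u v = ereal (awalk_cost (\<lambda>_. 1) p)"
    using min_cost_awalk[of u v "\<lambda>_. 1"] unfolding gdist_def by auto
  then show thesis
    using that awalkI_apath unfolding awalk_cost_1 by blast
qed

text \<open>A walk is a list of arcs, and an arc and its reverse are different objects. So reversing
  the list is not enough: \<open>sym_arcs\<close> has to supply an opposite arc for each
  entry.\<close>

lemma awalk_reverse: "awalk u p v \<Longrightarrow> \<exists>q. awalk v q u \<and> length q = length p"
proof (induction p arbitrary: u)
  case Nil
  then have "awalk v [] u" by (auto simp: awalk_Nil_iff)
  then show ?case by fastforce
next
  case (Cons e p)
  then have e: "e \<in> arcs G" "u = tail G e" and "awalk (head G e) p v"
    by (auto simp: awalk_Cons_iff)
  then obtain q where q: "awalk v q (head G e)" "length q = length p"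
    using Cons.IH by blast
  obtain e' where e': "e' \<in> arcs G" "tail G e' = head G e" "head G e' = tail G e"
    using sym_arcs e(1) unfolding symmetric_conv by metis
  have "awalk (head G e) [e'] u"
    using e e' by (auto simp: awalk_Cons_iff awalk_Nil_iff)
  with q(1) have "awalk v (q @ [e']) u" by (rule awalk_appendI)
  moreover have "length (q @ [e']) = length (e # p)" using q(2) by simp
  ultimately show ?case by blast
qed

lemma gdist_le_reverse: "gdist G v u \<le> gdist G u v"
proof (cases "gdist G u v < \<infinity>")
  case True
  then show ?thesis by (metis gdist_attained awalk_reverse gdist_le_length)
qed simp

lemma gdist_commute: "gdist G u v = gdist G v u"
  by (simp add: antisym gdist_le_reverse)

text \<open>Turns the conditions on color 1 into adjacency. For \<open>u = v\<close> the empty walk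
  would give distance 0 without any arc.\<close>

lemma gdist_le_1_iff:
  assumes "u \<noteq> v"
  shows "gdist G u v \<le> 1 \<longleftrightarrow> u \<rightarrow>\<^bsub>G\<^esub> v"
proof
  assume le: "gdist G u v \<le> 1"
  then have "gdist G u v < \<infinity>" by auto
  then obtain p where p: "awalk u p v" "gdist G u v = ereal (real (length p))"
    by (rule gdist_attained)
  with le have "length p \<le> 1" by simp
  moreover have "p \<noteq> []" using p assms by (auto simp: awalk_Nil_iff)
  ultimately obtain e where "p = [e]" by (cases p) auto
  then show "u \<rightarrow>\<^bsub>G\<^esub> v"
    using p by (auto simp: awalk_Cons_iff awalk_Nil_iff intro: in_arcs_imp_in_arcs_ends)
next
  assume "u \<rightarrow>\<^bsub>G\<^esub> v"
  then obtain e where "e \<in> arcs G" "tail G e = u" "head G e = v"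
    by (auto simp: arcs_ends_conv)
  then have "awalk u [e] v" by (auto simp: awalk_Cons_iff awalk_Nil_iff)
  then show "gdist G u v \<le> 1"
    using gdist_le_length[of u "[e]" v] by (simp add: one_ereal_def)
qed

section \<open>Consequences of diameter 3\<close>

lemma gdist_le_gdiam: "u \<in> verts G \<Longrightarrow> v \<in> verts G \<Longrightarrow> gdist G u v \<le> gdiam G"
  unfolding gdiam_def by (meson SUP_upper2 order_refl)

text \<open>Distances are lengths of walks, so none lies strictly between 2 and 3. This is why
  failing to be within distance 2 already means being diametrical.\<close>

lemma gdiam_3_cases:
  assumes "gdiam G = 3" "u \<in> verts G" "v \<in> verts G"
  shows "gdist G u v \<le> 2 \<or> gdist G u v = 3"
proof -
  have le: "gdist G u v \<le> 3" using gdist_le_gdiam assms by metis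
  then have "gdist G u v < \<infinity>" by auto
  then obtain p where "awalk u p v" and p: "gdist G u v = ereal (real (length p))"
    by (rule gdist_attained)
  with le have "length p \<le> 2 \<or> length p = 3" by auto
  with p show ?thesis by auto
qed

text \<open>Without arcs every walk is empty, so no finite distance is positive. The lemma
  guarantees that color 1 never exhausts the graph.\<close>

lemma gdiam_3_imp_arc:
  assumes "gdiam G = 3"
  shows "\<exists>u v. u \<rightarrow>\<^bsub>G\<^esub> v"
proof (rule ccontr)
  assume no_arc: "\<nexists>u v. u \<rightarrow>\<^bsub>G\<^esub> v"
  have "gdist G u v \<le> 0" if "u \<in> verts G" "v \<in> verts G" for u v
  proof -
    have "gdist G u v \<le> 3" using gdist_le_gdiam assms that by metis
    then have "gdist G u v < \<infinity>" by auto
    then obtain p where p: "awalk u p v" "gdist G u v = ereal (real (length p))"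
      by (rule gdist_attained)
    have "p = []"
      using p(1) no_arc by (cases p) (auto simp: awalk_Cons_iff dest: in_arcs_imp_in_arcs_ends)
    with p show ?thesis by simp
  qed
  then have "gdiam G \<le> 0" unfolding gdiam_def by (intro SUP_least)
  with assms show False by simp
qed

section \<open>Maximality as domination, the form taken by the Grundy condition\<close>

lemma maximal_independent_set_iff:
  "maximal_independent_set G A \<longleftrightarrow>
     independent_set G A \<and> (\<forall>v\<in>verts G - A. \<exists>u\<in>A. u \<rightarrow>\<^bsub>G\<^esub> v)"
proof -
  have sym: "u \<rightarrow>\<^bsub>G\<^esub> v" if "v \<rightarrow>\<^bsub>G\<^esub> u" for u v
    using that sym_arcs by (rule arcs_ends_symmetric[rotated])
  have irrefl: "\<not> v \<rightarrow>\<^bsub>G\<^esub> v" for v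
    using no_loops by (auto simp: arcs_ends_conv)
  have "(\<nexists>B. independent_set G B \<and> A \<subset> B) \<longleftrightarrow> (\<forall>v\<in>verts G - A. \<exists>u\<in>A. u \<rightarrow>\<^bsub>G\<^esub> v)"
    if A: "independent_set G A"
  proof
    assume max: "\<nexists>B. independent_set G B \<and> A \<subset> B"
    show "\<forall>v\<in>verts G - A. \<exists>u\<in>A. u \<rightarrow>\<^bsub>G\<^esub> v"
    proof
      fix v assume v: "v \<in> verts G - A"
      then have "A \<subset> insert v A" by auto
      then have "\<not> independent_set G (insert v A)" using max by blast
      then show "\<exists>u\<in>A. u \<rightarrow>\<^bsub>G\<^esub> v"
        using A v sym irrefl unfolding independent_set_def by blast
    qed
  next
    assume "\<forall>v\<in>verts G - A. \<exists>u\<in>A. u \<rightarrow>\<^bsub>G\<^esub> v"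
    then show "\<nexists>B. independent_set G B \<and> A \<subset> B"
      unfolding independent_set_def by blast
  qed
  then show ?thesis unfolding maximal_independent_set_def by blast
qed

lemma clique_delete_diametrical_iff:
  assumes "gdiam G = 3"
  shows "clique (delete_verts (diametrical_graph G) A) Q \<longleftrightarrow>
     Q \<subseteq> verts G - A \<and> (\<forall>u\<in>Q. \<forall>v\<in>Q. u \<noteq> v \<longrightarrow> gdist G u v = 3)"
proof -
  have "u \<rightarrow>\<^bsub>delete_verts (diametrical_graph G) A\<^esub> v \<longleftrightarrow>
      u \<in> verts G - A \<and> v \<in> verts G - A \<and> diametrical_pair G u v" for u v
    by (auto simp: delete_verts_def diametrical_graph_def arcs_ends_conv induce_subgraph_def
        image_iff)
  moreover have "verts (delete_verts (diametrical_graph G) A) = verts G - A"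
    by (simp add: delete_verts_def diametrical_graph_def)
  ultimately show ?thesis
    unfolding clique_def diametrical_pair_def assms by blast
qed

text \<open>A vertex that cannot be added to \<open>Q\<close> has some member of \<open>Q\<close> at
  a distance other than 3, which by \<open>gdiam_3_cases\<close> is at most 2. This is the Grundy
  condition for color 2.\<close>

lemma maximal_clique_delete_diametrical_iff:
  assumes "gdiam G = 3"
  shows "maximal_clique (delete_verts (diametrical_graph G) A) Q \<longleftrightarrow>
     clique (delete_verts (diametrical_graph G) A) Q \<and>
     (\<forall>v\<in>verts G - A - Q. \<exists>u\<in>Q. gdist G u v \<le> 2)" (is "_ \<longleftrightarrow> clique ?D Q \<and> ?dom")
proof -
  note clique_iff = clique_delete_diametrical_iff[OF assms]
  have "(\<nexists>R. clique ?D R \<and> Q \<subset> R) \<longleftrightarrow> ?dom" if Q: "clique ?D Q"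
  proof
    assume max: "\<nexists>R. clique ?D R \<and> Q \<subset> R"
    show ?dom
    proof
      fix v assume v: "v \<in> verts G - A - Q"
      then have "Q \<subset> insert v Q" by auto
      then have "\<not> clique ?D (insert v Q)" using max by blast
      \<comment> \<open>Cliques are tested on ordered pairs, so the failing pair may be
        \<open>(v, u)\<close>; \<open>gdist_commute\<close> turns it round.\<close>
      then obtain u where u: "u \<in> Q" "gdist G u v \<noteq> 3"
        using Q v unfolding clique_iff by (metis Diff_iff gdist_commute insert_iff insert_subset)
      then show "\<exists>u\<in>Q. gdist G u v \<le> 2"
        using Q v gdiam_3_cases[OF assms, of u v] unfolding clique_iff by blast
    qed
  next
    assume dom: ?dom
    show "\<nexists>R. clique ?D R \<and> Q \<subset> R"
    proof
      assume "\<exists>R. clique ?D R \<and> Q \<subset> R"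
      then obtain R v where R: "clique ?D R" "Q \<subset> R" and v: "v \<in> R" "v \<notin> Q"
        by blast
      then obtain u where u: "u \<in> Q" "gdist G u v \<le> 2"
        using dom unfolding clique_iff by blast
      have "u \<in> R" "u \<noteq> v" using u R(2) v by blast+
      with v(1) have "gdist G u v = 3" using R(1) unfolding clique_iff by simp
      with u show False by simp
    qed
  qed
  then show ?thesis unfolding maximal_clique_def by blast
qed

section \<open>Existence of maximal sets\<close>

lemma maximal_independent_set_exists: "\<exists>A. maximal_independent_set G A"
proof -
  have "finite {A. independent_set G A}"
    by (rule finite_subset[of _ "Pow (verts G)"]) (auto simp: independent_set_def)
  moreover have "{} \<in> {A. independent_set G A}" by (simp add: independent_set_def)
  ultimately obtain A where "independent_set G A" "\<forall>B. independent_set G B \<longrightarrow> A \<subseteq> B \<longrightarrow> A = B"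
    using finite_has_maximal[of "{A. independent_set G A}"] by auto
  then show ?thesis unfolding maximal_independent_set_def by blast
qed

end

text \<open>Kept outside the locale: it will be applied to the diametrical graph minus
  \<open>A\<close>, which thus need not be shown to be an instance of \<open>graph\<close>.\<close>

lemma maximal_clique_exists:
  assumes "finite (verts H)"
  shows "\<exists>Q. maximal_clique H Q"
proof -
  have "finite {Q. clique H Q}"
    by (rule finite_subset[of _ "Pow (verts H)"]) (auto simp: clique_def assms)
  moreover have "{} \<in> {Q. clique H Q}" by (simp add: clique_def)
  ultimately obtain Q where "clique H Q" "\<forall>R. clique H R \<longrightarrow> Q \<subseteq> R \<longrightarrow> Q = R"
    using finite_has_maximal[of "{Q. clique H Q}"] by auto
  then show ?thesis unfolding maximal_clique_def by blast
qed

lemma minimum_maximal_clique_exists: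
  assumes "finite (verts H)"
  shows "\<exists>Q. minimum_maximal_clique H Q"
proof -
  obtain Q0 where "maximal_clique H Q0" using maximal_clique_exists[OF assms] ..
  then show ?thesis
    unfolding minimum_maximal_clique_def
    by (rule ex_has_least_nat[of "maximal_clique H" Q0 card, THEN exE]) blast
qed

section \<open>Grundy packing colorings versus pairs \<open>A\<close>, \<open>Q\<close>\<close>

context graph
begin

text \<open>The packing condition makes color 1 independent and puts the vertices of color 2 at
  mutual distance 3; the Grundy condition makes both classes maximal. The count uses sums only,
  which avoids truncated subtraction.\<close>

lemma grundy_packing_coloring_classes:
  assumes diam: "gdiam G = 3" and c: "grundy_packing_coloring G k c"
  obtains A Q where "maximal_independent_set G A"
    and "maximal_clique (delete_verts (diametrical_graph G) A) Q"
    and "k + card A + card Q = card (verts G) + 2"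
proof -
  define A where "A = {v \<in> verts G. c v = 1}"
  define Q where "Q = {v \<in> verts G. c v = 2}"
  define R where "R = {v \<in> verts G. c v \<ge> 3}"
  have pack: "gdist G u v > ereal (real (c u))"
    if "u \<in> verts G" "v \<in> verts G" "u \<noteq> v" "c u = c v" for u v
    using c that unfolding grundy_packing_coloring_def packing_coloring_def by blast
  have img: "c ` verts G = {1..k}"
    using c unfolding grundy_packing_coloring_def by blast
  have grundy: "\<exists>u\<in>verts G. c u = j \<and> gdist G u v \<le> ereal (real j)"
    if "v \<in> verts G" "1 \<le> j" "j < c v" for v j
    using c that unfolding grundy_packing_coloring_def by fastforce
  have c_pos: "c v \<ge> 1" if "v \<in> verts G" for v
    using img that by (metis atLeastAtMost_iff imageI)
  have irrefl: "\<not> v \<rightarrow>\<^bsub>G\<^esub> v" for v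
    using no_loops by (auto simp: arcs_ends_conv)
  have indep: "independent_set G A"
    unfolding independent_set_def
  proof (intro conjI ballI notI)
    fix u v assume uv: "u \<in> A" "v \<in> A" "u \<rightarrow>\<^bsub>G\<^esub> v"
    then have "u \<noteq> v" using irrefl by blast
    then show False
      using uv pack[of u v] gdist_le_1_iff[of u v] by (auto simp: A_def one_ereal_def)
  qed (auto simp: A_def)
  have A: "maximal_independent_set G A"
    unfolding maximal_independent_set_iff
  proof (intro conjI ballI indep)
    fix v assume v: "v \<in> verts G - A"
    then have "1 < c v" using c_pos[of v] by (auto simp: A_def)
    then obtain u where u: "u \<in> verts G" "c u = 1" "gdist G u v \<le> 1"
      using grundy[of v 1] v by (auto simp: one_ereal_def)
    then have "u \<in> A" "u \<noteq> v" using v by (auto simp: A_def)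
    then show "\<exists>u\<in>A. u \<rightarrow>\<^bsub>G\<^esub> v" using u gdist_le_1_iff by blast
  qed
  have Q: "maximal_clique (delete_verts (diametrical_graph G) A) Q"
    unfolding maximal_clique_delete_diametrical_iff[OF diam] clique_delete_diametrical_iff[OF diam]
  proof (intro conjI ballI impI)
    show "Q \<subseteq> verts G - A" by (auto simp: Q_def A_def)
  next
    fix u v assume uv: "u \<in> Q" "v \<in> Q" "u \<noteq> v"
    then have "\<not> gdist G u v \<le> 2"
      using pack[of u v] by (auto simp: Q_def)
    then show "gdist G u v = 3"
      using uv gdiam_3_cases[OF diam, of u v] by (auto simp: Q_def)
  next
    fix v assume v: "v \<in> verts G - A - Q"
    then have "c v \<noteq> 1" "c v \<noteq> 2" "c v \<ge> 1" using c_pos[of v] by (auto simp: A_def Q_def)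
    then show "\<exists>u\<in>Q. gdist G u v \<le> 2"
      using grundy[of v 2] v by (auto simp: Q_def)
  qed
  \<comment> \<open>Otherwise all vertices would have color 1 and the graph would have no arc. The
    bound makes the natural number \<open>k - 2\<close> below a true difference.\<close>
  have "k \<ge> 2"
  proof (rule ccontr)
    assume "\<not> k \<ge> 2"
    moreover have "c v \<le> k" if "v \<in> verts G" for v
      using img that by (metis atLeastAtMost_iff imageI)
    ultimately have "verts G \<subseteq> A" using c_pos by (fastforce simp: A_def)
    moreover obtain u v where "u \<rightarrow>\<^bsub>G\<^esub> v" using gdiam_3_imp_arc[OF diam] by blast
    ultimately show False
      using indep adj_in_verts[of u v] unfolding independent_set_def by blast
  qed
  \<comment> \<open>Two vertices sharing a color of at least 3 would be more than 3 apart, beyond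
    the diameter.\<close>
  have "inj_on c R"
  proof (rule inj_onI, rule ccontr)
    fix u v assume uv: "u \<in> R" "v \<in> R" "c u = c v" "u \<noteq> v"
    then have "gdist G u v > ereal (real (c u))" "gdist G u v \<le> 3"
      using pack[of u v] gdist_le_gdiam[of u v] diam by (auto simp: R_def)
    then have "ereal (real (c u)) < 3" by (rule less_le_trans)
    then show False using uv by (auto simp: R_def)
  qed
  moreover have "c ` R = {3..k}"
  proof
    show "c ` R \<subseteq> {3..k}" using img by (auto simp: R_def)
    show "{3..k} \<subseteq> c ` R"
    proof
      fix i assume i: "i \<in> {3..k}"
      then have "i \<in> c ` verts G" using img by auto
      with i show "i \<in> c ` R" by (auto simp: R_def)
    qed
  qed
  ultimately have "card R = k - 2"
    using card_image[of c R] by simp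
  moreover have "verts G = A \<union> Q \<union> R"
    using c_pos by (fastforce simp: A_def Q_def R_def)
  moreover have "card (A \<union> Q \<union> R) = card A + card Q + card R"
  proof -
    have "A \<inter> Q = {}" "(A \<union> Q) \<inter> R = {}" "finite A" "finite Q" "finite R"
      by (auto simp: A_def Q_def R_def)
    then show ?thesis by (simp add: card_Un_disjoint)
  qed
  ultimately have "k + card A + card Q = card (verts G) + 2"
    using \<open>k \<ge> 2\<close> by simp
  with A Q show thesis by (rule that)
qed

text \<open>Give \<open>A\<close> color 1, \<open>Q\<close> color 2, and number the remaining
  vertices from 3 on. Their order is irrelevant, since all of them are within distance 3 of every
  vertex.\<close>

lemma grundy_packing_coloring_of_classes:
  assumes diam: "gdiam G = 3" and A: "maximal_independent_set G A"
    and Q: "maximal_clique (delete_verts (diametrical_graph G) A) Q"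
  obtains c k where "grundy_packing_coloring G k c"
    and "k + card A + card Q = card (verts G) + 2"
proof -
  define R where "R = verts G - A - Q"
  have AV: "A \<subseteq> verts G" and indep: "\<And>u v. u \<in> A \<Longrightarrow> v \<in> A \<Longrightarrow> \<not> u \<rightarrow>\<^bsub>G\<^esub> v"
    and A_dom: "\<And>v. v \<in> verts G - A \<Longrightarrow> \<exists>u\<in>A. u \<rightarrow>\<^bsub>G\<^esub> v"
    using A unfolding maximal_independent_set_iff independent_set_def by auto
  have QV: "Q \<subseteq> verts G - A"
    and Q_far: "\<And>u v. u \<in> Q \<Longrightarrow> v \<in> Q \<Longrightarrow> u \<noteq> v \<Longrightarrow> gdist G u v = 3"
    and Q_dom: "\<And>v. v \<in> verts G - A - Q \<Longrightarrow> \<exists>u\<in>Q. gdist G u v \<le> 2"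
    using Q unfolding maximal_clique_delete_diametrical_iff[OF diam]
      clique_delete_diametrical_iff[OF diam] by auto
  have fin: "finite A" "finite Q" "finite R"
    using finite_subset[OF AV] finite_subset[OF QV] by (simp_all add: R_def)
  \<comment> \<open>An arc cannot have both ends in \<open>A\<close>, so some \<open>w\<close> lies
    outside. Domination of \<open>w\<close> makes \<open>A\<close> nonempty, and \<open>Q\<close>
    contains \<open>w\<close> or a vertex near it. Hence colors 1 and 2 are really used.\<close>
  obtain u v where uv: "u \<rightarrow>\<^bsub>G\<^esub> v" using gdiam_3_imp_arc[OF diam] by blast
  then have "\<exists>w. w \<in> verts G - A"
    using indep adj_in_verts[OF uv] by blast
  then obtain w where w: "w \<in> verts G - A" ..
  have "A \<noteq> {}" using A_dom[OF w] by blast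
  have "Q \<noteq> {}" using Q_dom[of w] w by blast
  obtain f where f: "bij_betw f R {0..<card R}"
    using ex_bij_betw_finite_nat[OF fin(3)] by blast
  \<comment> \<open>The enumeration \<open>f\<close> starts at 0, so the shift by 3 makes the colors
    on \<open>R\<close> run from 3 to \<open>card R + 2\<close>, which is \<open>k\<close>.\<close>
  define c where "c v = (if v \<in> A then 1 else if v \<in> Q then 2 else f v + 3)" for v
  define k where "k = card R + 2"
  have V: "verts G = A \<union> Q \<union> R" using AV QV by (auto simp: R_def)
  have cA: "c v = 1" if "v \<in> A" for v using that by (simp add: c_def)
  have cQ: "c v = 2" if "v \<in> Q" for v using that QV by (auto simp: c_def)
  have cR: "c v = f v + 3" if "v \<in> R" for v using that by (simp add: c_def R_def)
  have c1: "c v = 1 \<longleftrightarrow> v \<in> A" and c2: "c v = 2 \<longleftrightarrow> v \<in> Q" and c3: "c v \<ge> 3 \<longleftrightarrow> v \<in> R"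
    if "v \<in> verts G" for v
    using that QV by (auto simp: c_def R_def)
  have "c ` R = (\<lambda>i. i + 3) ` f ` R" using cR by (auto simp: image_image)
  also have "\<dots> = {3..<card R + 3}"
    using f by (simp add: bij_betw_def)
  also have "\<dots> = {3..k}" by (auto simp: k_def)
  finally have imgR: "c ` R = {3..k}" .
  moreover have "c ` A = {1}" "c ` Q = {2}"
    using \<open>A \<noteq> {}\<close> \<open>Q \<noteq> {}\<close> cA cQ by force+
  ultimately have img: "c ` verts G = {1..k}"
    unfolding V image_Un by (auto simp: k_def)
  have "packing_coloring G k c"
    unfolding packing_coloring_def
  proof (intro conjI ballI impI)
    show "c ` verts G \<subseteq> {1..k}" using img by simp
  next
    fix u v assume uv: "u \<in> verts G" "v \<in> verts G" "u \<noteq> v \<and> c u = c v"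
    \<comment> \<open>Colors of at least 3 occur exactly on \<open>R\<close>, each once, so two
      vertices of equal color lie together in \<open>A\<close> or in \<open>Q\<close>.\<close>
    have "inj_on c R"
      using f cR by (auto simp: inj_on_def bij_betw_def)
    moreover have "v \<in> R" if "u \<in> R" using that uv c3[of u] c3[of v] by simp
    ultimately have "u \<notin> R" using uv by (auto dest: inj_onD)
    then consider "u \<in> A" | "u \<in> Q" using uv V by blast
    then show "gdist G u v > ereal (real (c u))"
    proof cases
      case 1
      then have "v \<in> A" using c1 uv by metis
      then have "\<not> gdist G u v \<le> 1" using 1 indep gdist_le_1_iff uv by blast
      then show ?thesis using cA[OF 1] by (simp add: one_ereal_def)
    next
      case 2
      then have "v \<in> Q" using c2 uv by metis
      then have "gdist G u v = 3" using 2 Q_far uv by blast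
      then show ?thesis using cQ[OF 2] by simp
    qed
  qed
  moreover have "\<exists>u\<in>verts G. c u = j \<and> gdist G u v \<le> ereal (real j)"
    if v: "v \<in> verts G" and j: "j \<in> {1..<c v}" for v j
  proof -
    consider "j = 1" | "j = 2" | "j \<ge> 3" using j by fastforce
    then show ?thesis
    proof cases
      case 1
      then have "v \<in> verts G - A" using v j cA[of v] by auto
      then obtain u where u: "u \<in> A" "u \<rightarrow>\<^bsub>G\<^esub> v" using A_dom by blast
      then have "u \<noteq> v" using \<open>v \<in> verts G - A\<close> by blast
      then have "gdist G u v \<le> 1" using u gdist_le_1_iff by blast
      then show ?thesis using u AV cA 1 by (auto simp: one_ereal_def)
    next
      case 2
      then have "v \<in> verts G - A - Q" using v j cA[of v] cQ[of v] by auto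
      then obtain u where u: "u \<in> Q" "gdist G u v \<le> 2" using Q_dom by blast
      then show ?thesis using QV cQ 2 by auto
    next
      case 3
      \<comment> \<open>As \<open>j\<close> is below \<open>c v\<close>, it is at most
        \<open>k\<close> and so is used on \<open>R\<close>; the vertex that bears it is within 3,
        hence within \<open>j\<close>, of \<open>v\<close>.\<close>
      have "c v \<le> k" using img v by (metis atLeastAtMost_iff imageI)
      then have "j \<in> c ` R" using imgR 3 j by auto
      then obtain u where u: "u \<in> R" "c u = j" by blast
      then have "gdist G u v \<le> 3" using gdist_le_gdiam[of u v] diam v by (auto simp: R_def)
      also have "3 \<le> ereal (real j)" using 3 by simp
      finally show ?thesis using u by (auto simp: R_def)
    qed
  qed
  ultimately have "grundy_packing_coloring G k c"
    using img unfolding grundy_packing_coloring_def by blast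
  moreover have "card (A \<union> Q \<union> R) = card A + card Q + card R"
  proof -
    have "A \<inter> Q = {}" "(A \<union> Q) \<inter> R = {}" using QV by (auto simp: R_def)
    then show ?thesis using fin by (simp add: card_Un_disjoint)
  qed
  then have "k + card A + card Q = card (verts G) + 2"
    using V by (simp add: k_def)
  ultimately show thesis by (rule that)
qed

end

section \<open>Passing to the extremal pair\<close>

theorem theorem13:
  fixes G :: "('a, 'b) pre_digraph"
  assumes "graph G" and "gdiam G = 3"
  shows "int (grundy_packing_number G) = int (card (verts G)) - int (m_number G) + 2"
proof -
  interpret graph G by fact
  let ?D = "\<lambda>A. delete_verts (diametrical_graph G) A"
  define M where "M = {card A + card Q | A Q.
     maximal_independent_set G A \<and> minimum_maximal_clique (?D A) Q}"
  define K where "K = {k. \<exists>c. grundy_packing_coloring G k c}"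
  have fin_D: "finite (verts (?D A))" for A
    by (simp add: delete_verts_def diametrical_graph_def)
  \<comment> \<open>A crude bound, wanted only for the finiteness of \<open>M\<close>, so that
    \<open>Min M\<close> is attained.\<close>
  have "card A + card Q \<le> card (verts G) + card (verts G)"
    if "maximal_independent_set G A" "minimum_maximal_clique (?D A) Q" for A Q
  proof -
    have "A \<subseteq> verts G"
      using that(1) unfolding maximal_independent_set_def independent_set_def by simp
    moreover have "clique (?D A) Q"
      using that(2) unfolding minimum_maximal_clique_def maximal_clique_def by simp
    then have "Q \<subseteq> verts G"
      by (auto simp: clique_delete_diametrical_iff[OF assms(2)])
    ultimately show ?thesis by (simp add: add_mono card_mono)
  qed
  then have "M \<subseteq> {..card (verts G) + card (verts G)}" unfolding M_def by blast
  then have "finite M" by (rule finite_subset) simp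
  moreover have "M \<noteq> {}"
    using maximal_independent_set_exists minimum_maximal_clique_exists[OF fin_D]
    unfolding M_def by blast
  ultimately have "Min M \<in> M" by (rule Min_in)
  then obtain A Q where AQ: "maximal_independent_set G A" "minimum_maximal_clique (?D A) Q"
    and m: "Min M = card A + card Q"
    unfolding M_def by blast
  from AQ(2) have "maximal_clique (?D A) Q"
    unfolding minimum_maximal_clique_def by blast
  with AQ(1) obtain k c where "grundy_packing_coloring G k c"
    and "k + card A + card Q = card (verts G) + 2"
    using grundy_packing_coloring_of_classes[OF assms(2)] by blast
  with m have k: "k + Min M = card (verts G) + 2" by simp
  have "k \<in> K" using \<open>grundy_packing_coloring G k c\<close> unfolding K_def by blast
  moreover have le: "k' \<le> k" if in_K: "k' \<in> K" for k'
  proof -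
    obtain c' where "grundy_packing_coloring G k' c'" using in_K unfolding K_def by blast
    then obtain A' Q' where A': "maximal_independent_set G A'"
      and Q': "maximal_clique (?D A') Q'"
      and k': "k' + card A' + card Q' = card (verts G) + 2"
      by (rule grundy_packing_coloring_classes[OF assms(2)])
    \<comment> \<open>The color class \<open>Q'\<close> is a maximal clique but perhaps not a
      smallest one. A minimum one for the same \<open>A'\<close> is no larger and contributes to
      \<open>M\<close>.\<close>
    obtain Q'' where Q'': "minimum_maximal_clique (?D A') Q''"
      using minimum_maximal_clique_exists[OF fin_D] by blast
    then have "card Q'' \<le> card Q'" using Q' unfolding minimum_maximal_clique_def by blast
    moreover have "card A' + card Q'' \<in> M" using A' Q'' unfolding M_def by blast
    then have "Min M \<le> card A' + card Q''" using \<open>finite M\<close> by simp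
    ultimately show ?thesis using k k' by linarith
  qed
  \<comment> \<open>Finiteness, which \<open>Max\<close> needs, comes from the upper bound
    \<open>k\<close> just proved.\<close>
  moreover have "finite K"
    using le by (intro finite_subset[of K "{..k}"]) auto
  ultimately have "Max K = k" by (intro Max_eqI) auto
  then show ?thesis
    using k unfolding grundy_packing_number_def m_number_def K_def M_def by linarith
qed

end
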